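(* Let $G$ be a group of homeomorphisms of the Cantor space $\mathcal{X}$ whose action is minimal, and let $[G]$ be the topological full group of $G$. Then, for all $x,y\in\mathcal{X}$, there exists a homeomorphism $f\colon\mathcal{X}\rightarrow\mathcal{X}$ such that $f\,\mathrm{St}_{[G]}^{0}(x)\,f^{-1}=\mathrm{St}_{[G]}^{0}(y)$. In particular, if $x$ and $y$ are regular points for the action of $G$ on $\mathcal{X}$, then $\mathrm{St}_{[G]}(x)$ and $\mathrm{St}_{[G]}(y)$ are isomorphic.
   Context: "Neighbourhood" always means open neighbourhood. - The topological full group $[G]$ of a group $G$ of homeomorphisms of the Cantor space $\mathcal{X}$ is the group of all homeomorphisms $h$ of $\mathcal{X}$ that are locally in $G$, i.e. such that for every $x\in\mathcal{X}$ there exist a neighbourhood $U$ of $x$ and an element $g\in G$ with $h|_U=g|_U$. - For a group $H$ of homeomorphisms of $\mathcal{X}$ and $x\in\mathcal{X}$, $\mathrm{St}_H(x)=\{h\in H\mid h(x)=x\}$, and the neighbourhood stabiliser $\mathrm{St}_H^0(x)$ is the subgroup of all $h\in \mathrm{St}_H(x)$ whose set of fixed points contains a neighbourhood of $x$. A point $x$ is regular for the action of $H$ if $\mathrm{St}_H^0(x)=\mathrm{St}_H(x)$. - An action is minimal if the orbit of every point is dense. *)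

theory Defs
  imports "HOL-Analysis.Analysis" "HOL-Algebra.Group"
begin

text \<open>The Cantor space is the product of countably many copies of the discrete space
  \<open>bool\<close>: the library equips function types with the product topology.\<close>

type_synonym cantor = "nat \<Rightarrow> bool"

definition homeo_group :: "('a::topological_space \<Rightarrow> 'a) monoid"
  where "homeo_group = \<lparr>carrier = {h. homeomorphic_map euclidean euclidean h}, mult = (\<circ>), one = id\<rparr>"

definition minimal_action :: "('a::topological_space \<Rightarrow> 'a) set \<Rightarrow> bool"
  where "minimal_action G \<longleftrightarrow> (\<forall>x. closure {g x | g. g \<in> G} = UNIV)"

definition topological_full_group :: "('a::topological_space \<Rightarrow> 'a) set \<Rightarrow> ('a \<Rightarrow> 'a) set"
  where "topological_full_group G =
    {h \<in> carrier homeo_group.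
       \<forall>x. \<exists>U. open U \<and> x \<in> U \<and> (\<exists>g\<in>G. \<forall>u\<in>U. h u = g u)}"

definition point_stabiliser :: "('a \<Rightarrow> 'a) set \<Rightarrow> 'a \<Rightarrow> ('a \<Rightarrow> 'a) set"
  where "point_stabiliser H x = {h \<in> H. h x = x}"

definition neighbourhood_stabiliser ::
    "('a::topological_space \<Rightarrow> 'a) set \<Rightarrow> 'a \<Rightarrow> ('a \<Rightarrow> 'a) set"
  where "neighbourhood_stabiliser H x =
    {h \<in> point_stabiliser H x. \<exists>U. open U \<and> x \<in> U \<and> U \<subseteq> {u. h u = u}}"

definition regular_point :: "('a::topological_space \<Rightarrow> 'a) set \<Rightarrow> 'a \<Rightarrow> bool"
  where "regular_point H x \<longleftrightarrow> neighbourhood_stabiliser H x = point_stabiliser H x"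

lemma homeo_group_simps [simp]:
  "h \<in> carrier homeo_group \<longleftrightarrow> homeomorphic_map euclidean euclidean h"
  "mult homeo_group = (\<circ>)"
  "one homeo_group = id"
  by (simp_all add: homeo_group_def)

lemma homeo_group_bij: "h \<in> carrier homeo_group \<Longrightarrow> bij h"
  by (simp add: homeomorphic_eq_everything_map bij_def)

lemma homeo_group_open_vimage:
  assumes "h \<in> carrier homeo_group" "open U"
  shows "open (h -` U)"
  using assms by (simp add: homeomorphic_eq_everything_map open_vimage)

lemma homeo_group_inv_closed:
  assumes "h \<in> carrier homeo_group"
  shows "inv_into UNIV h \<in> carrier homeo_group"
proof -
  obtain k where k: "homeomorphic_maps euclidean euclidean h k"
    using assms by (auto simp: homeomorphic_map_maps)
  then have "inv_into UNIV h = k"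
    by (intro inv_equality) (auto simp: homeomorphic_maps_def)
  then show ?thesis
    using k homeomorphic_maps_sym homeomorphic_map_maps by (metis homeo_group_simps(1))
qed

lemma homeo_group_comp:
  "\<lbrakk>g \<in> carrier homeo_group; h \<in> carrier homeo_group\<rbrakk> \<Longrightarrow> g \<circ> h \<in> carrier homeo_group"
  unfolding homeo_group_simps by (rule homeomorphic_map_compose)

lemma group_homeo_group: "group (homeo_group :: ('a::topological_space \<Rightarrow> 'a) monoid)"
proof (rule groupI)
  fix h :: "'a \<Rightarrow> 'a"
  assume h: "h \<in> carrier homeo_group"
  then have "inv_into UNIV h \<circ> h = id"
    using homeo_group_bij bij_is_inj inv_o_cancel by blast
  then show "\<exists>k\<in>carrier homeo_group. k \<otimes>\<^bsub>homeo_group\<^esub> h = \<one>\<^bsub>homeo_group\<^esub>"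
    using homeo_group_inv_closed [OF h] by auto
qed (simp_all add: comp_assoc homeo_group_comp del: homeo_group_simps(1), simp)

lemma homeo_group_inv:
  assumes "h \<in> carrier homeo_group"
  shows "inv\<^bsub>homeo_group\<^esub> h = inv_into UNIV h"
proof (rule group.inv_equality [OF group_homeo_group])
  show "inv_into UNIV h \<otimes>\<^bsub>homeo_group\<^esub> h = \<one>\<^bsub>homeo_group\<^esub>"
    using homeo_group_bij [OF assms] by (simp add: bij_is_inj)
qed (use assms homeo_group_inv_closed [OF assms] in simp_all)

lemma subgroup_topological_full_group:
  assumes G: "subgroup G homeo_group"
  shows "subgroup (topological_full_group G) homeo_group"
proof (rule group.subgroupI [OF group_homeo_group])
  show "topological_full_group G \<subseteq> carrier homeo_group"
    by (auto simp: topological_full_group_def)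
  have "id \<in> G" using subgroup.one_closed [OF G] by simp
  then have "\<exists>U. open U \<and> x \<in> U \<and> (\<exists>g\<in>G. \<forall>u\<in>U. id u = g u)" for x
    by (intro exI [of _ UNIV] conjI bexI [of _ id]) simp_all
  then have "id \<in> topological_full_group G"
    by (simp add: topological_full_group_def)
  then show "topological_full_group G \<noteq> {}" by blast
next
  fix h assume h: "h \<in> topological_full_group G"
  then have hc: "h \<in> carrier homeo_group" by (simp add: topological_full_group_def)
  let ?k = "inv_into UNIV h"
  have kc: "?k \<in> carrier homeo_group" using homeo_group_inv_closed [OF hc] .
  have hk: "h (?k u) = u" for u
    using homeo_group_bij [OF hc] by (simp add: bij_is_surj surj_f_inv_f)
  have "\<exists>U. open U \<and> x \<in> U \<and> (\<exists>g\<in>G. \<forall>u\<in>U. ?k u = g u)" for x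
  proof -
    obtain U g where U: "open U" "?k x \<in> U" "g \<in> G" "\<forall>u\<in>U. h u = g u"
      using h unfolding topological_full_group_def by blast
    have gc: "g \<in> carrier homeo_group" using subgroup.subset [OF G] U(3) by blast
    have "inv_into UNIV g \<in> G"
      using subgroup.m_inv_closed [OF G U(3)] by (simp add: homeo_group_inv [OF gc])
    moreover have "?k u = inv_into UNIV g u" if "u \<in> ?k -` U" for u
    proof -
      have "g (?k u) = u" using that U(4) hk [of u] by auto
      then show ?thesis using homeo_group_bij [OF gc] by (metis bij_inv_eq_iff)
    qed
    ultimately show ?thesis
      using homeo_group_open_vimage [OF kc U(1)] U(2) by blast
  qed
  then show "inv\<^bsub>homeo_group\<^esub> h \<in> topological_full_group G"
    using kc by (simp add: topological_full_group_def homeo_group_inv [OF hc])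
next
  fix h k assume h: "h \<in> topological_full_group G" and k: "k \<in> topological_full_group G"
  have kc: "k \<in> carrier homeo_group" using k by (simp add: topological_full_group_def)
  have "\<exists>U. open U \<and> x \<in> U \<and> (\<exists>g\<in>G. \<forall>u\<in>U. (h \<circ> k) u = g u)" for x
  proof -
    obtain U a where U: "open U" "k x \<in> U" "a \<in> G" "\<forall>u\<in>U. h u = a u"
      using h unfolding topological_full_group_def by blast
    obtain V b where V: "open V" "x \<in> V" "b \<in> G" "\<forall>u\<in>V. k u = b u"
      using k unfolding topological_full_group_def by blast
    have "a \<circ> b \<in> G" using subgroup.m_closed [OF G U(3) V(3)] by simp
    moreover have "open (V \<inter> k -` U)" using homeo_group_open_vimage [OF kc U(1)] V(1) by blast
    moreover have "(h \<circ> k) u = (a \<circ> b) u" if "u \<in> V \<inter> k -` U" for u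
      using that U(4) V(4) by (metis IntE comp_apply vimageE)
    ultimately show ?thesis
      using U(2) V(2) by (intro exI [of _ "V \<inter> k -` U"] conjI bexI [of _ "a \<circ> b"] ballI) blast+
  qed
  then show "h \<otimes>\<^bsub>homeo_group\<^esub> k \<in> topological_full_group G"
    using h k homeo_group_comp [of h k] by (simp add: topological_full_group_def)
qed

end

theory Submission
  imports Defs
begin

text \<open>A homeomorphism \<open>f\<close> with \<open>f x = y\<close> that coincides locally with elements of \<open>G\<close> away from
  \<open>x\<close> conjugates the neighbourhood stabiliser of \<open>x\<close> onto that of \<open>y\<close>: a conjugate is trivial near
  \<open>y\<close> and is locally in \<open>G\<close> elsewhere. If \<open>y\<close> is in the orbit of \<open>x\<close>, an element of \<open>G\<close> serves
  as \<open>f\<close>. Otherwise \<open>f\<close> is a limit of elements \<open>h\<^sub>n\<close> of the full group, where \<open>h\<^sub>n\<close> maps a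
  clopen \<open>A\<^sub>n\<close> containing \<open>x\<close> onto a clopen \<open>B\<^sub>n\<close> containing \<open>y\<close>, \<open>h\<^sub>n\<^sub>+\<^sub>1 = h\<^sub>n\<close> off \<open>A\<^sub>n\<close>,
  and both sequences of sets shrink to points. To pass from \<open>n\<close> to \<open>n + 1\<close>, minimality provides one
  involution that moves the preimage of \<open>y\<close> close to \<open>x\<close> and another one that then moves the
  image of \<open>x\<close> close to \<open>y\<close>.\<close>

section \<open>Maps that are locally in a group\<close>

text \<open>The condition defining the full group, taken at a single point so that it can be
  required everywhere except at \<open>x\<close>.\<close>

definition locally_in :: "('a::topological_space \<Rightarrow> 'a) set \<Rightarrow> ('a \<Rightarrow> 'a) \<Rightarrow> 'a \<Rightarrow> bool"
  where "locally_in G h p \<longleftrightarrow> (\<exists>U. open U \<and> p \<in> U \<and> (\<exists>g\<in>G. \<forall>u\<in>U. h u = g u))"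

lemma topological_full_group_iff:
  "h \<in> topological_full_group G \<longleftrightarrow> homeomorphic_map euclidean euclidean h \<and> (\<forall>p. locally_in G h p)"
  by (auto simp: topological_full_group_def locally_in_def)

lemma locally_inI:
  "open U \<Longrightarrow> p \<in> U \<Longrightarrow> g \<in> G \<Longrightarrow> (\<And>u. u \<in> U \<Longrightarrow> h u = g u) \<Longrightarrow> locally_in G h p"
  by (auto simp: locally_in_def)

lemma homeomorphic_map_euclidean_iff:
  fixes h :: "'a::topological_space \<Rightarrow> 'a"
  shows "homeomorphic_map euclidean euclidean h \<longleftrightarrow>
     bij h \<and> continuous_on UNIV h \<and> continuous_on UNIV (inv_into UNIV h)" (is "?L \<longleftrightarrow> ?R")
proof
  assume L: ?L
  have "bij h" using L homeo_group_bij[of h] by simp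
  moreover have "homeomorphic_map euclidean euclidean (inv_into UNIV h)"
    using homeo_group_inv_closed[of h] L by simp
  ultimately show ?R
    using L homeomorphic_imp_continuous_map[of euclidean euclidean] by auto
next
  assume ?R
  then have "homeomorphic_maps euclidean euclidean h (inv_into UNIV h)"
    by (auto simp: homeomorphic_maps_def bij_is_inj bij_is_surj surj_f_inv_f)
  then show ?L
    using homeomorphic_map_maps by blast
qed

lemma locally_in_comp:
  assumes G: "subgroup G homeo_group" and k: "locally_in G k p" and h: "locally_in G h (k p)"
  shows "locally_in G (h \<circ> k) p"
proof -
  obtain U a where U: "open U" "k p \<in> U" "a \<in> G" "\<forall>u\<in>U. h u = a u"
    using h by (auto simp: locally_in_def)
  obtain V b where V: "open V" "p \<in> V" "b \<in> G" "\<forall>u\<in>V. k u = b u"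
    using k by (auto simp: locally_in_def)
  \<comment> \<open>\<open>k\<close> is not assumed continuous, so the preimage is taken under
    \<open>b\<close>, which is continuous and agrees with \<open>k\<close> on
    \<open>V\<close>.\<close>
  have "open (b -` U)"
    using homeo_group_open_vimage U(1) subgroup.subset[OF G] V(3) by blast
  moreover have "a \<circ> b \<in> G"
    using subgroup.m_closed[OF G U(3) V(3)] by simp
  ultimately show ?thesis
    using U V by (intro locally_inI[of "V \<inter> b -` U" p "a \<circ> b"]) auto
qed

lemma id_mem: "subgroup G homeo_group \<Longrightarrow> id \<in> G"
  using subgroup.one_closed by fastforce

lemma inv_mem:
  assumes "subgroup G homeo_group" "g \<in> G"
  shows "inv_into UNIV g \<in> G"
  using assms subgroup.m_inv_closed[OF assms] subgroup.subset[OF assms(1)] homeo_group_inv[of g]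
  by auto

lemma homeomorphic_map_mem:
  assumes "subgroup G homeo_group" "g \<in> G"
  shows "homeomorphic_map euclidean euclidean g"
  using assms subgroup.subset homeo_group_simps(1) by blast

lemma locally_in_inv:
  assumes G: "subgroup G homeo_group" and f: "homeomorphic_map euclidean euclidean f"
    and "locally_in G f p"
  shows "locally_in G (inv_into UNIV f) (f p)"
proof -
  obtain U g where U: "open U" "p \<in> U" "g \<in> G" "\<forall>u\<in>U. f u = g u"
    using assms(3) by (auto simp: locally_in_def)
  have bf: "bij f" and cf: "continuous_on UNIV (inv_into UNIV f)"
    using f by (auto simp: homeomorphic_map_euclidean_iff)
  have bg: "bij g"
    using homeomorphic_map_mem[OF G U(3)] by (auto simp: homeomorphic_map_euclidean_iff)
  have "inv_into UNIV f q = inv_into UNIV g q" if "inv_into UNIV f q \<in> U" for q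
    using U(4) that bf bg by (metis bij_inv_eq_iff)
  moreover have "open (inv_into UNIV f -` U)" using cf U(1) by (simp add: open_vimage)
  moreover have "f p \<in> inv_into UNIV f -` U"
    using bf U(2) by (simp add: bij_is_inj)
  ultimately show ?thesis
    using inv_mem[OF G U(3)]
    by (intro locally_inI[of "inv_into UNIV f -` U" _ "inv_into UNIV g"]) auto
qed

lemma locally_in_mem: "g \<in> G \<Longrightarrow> locally_in G g p"
  by (rule locally_inI[of UNIV]) auto

text \<open>Continuity is local, and near each point the map agrees with a homeomorphism from
  \<open>G\<close>. This serves for maps defined piecewise.\<close>

lemma locally_in_continuous:
  assumes G: "subgroup G homeo_group" and "\<And>p. locally_in G h p"
  shows "continuous_on UNIV h"
proof -
  have "\<exists>S. open S \<and> p \<in> S \<and> S \<subseteq> h -` T" if T: "open T" "h p \<in> T" for p T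
  proof -
    obtain U g where U: "open U" "p \<in> U" "g \<in> G" "\<forall>u\<in>U. h u = g u"
      using assms(2)[of p] by (auto simp: locally_in_def)
    have "open (g -` T)"
      using homeomorphic_map_mem[OF G U(3)] T(1)
      by (simp add: homeomorphic_map_euclidean_iff open_vimage)
    then show ?thesis using U T by (intro exI[of _ "U \<inter> g -` T"]) auto
  qed
  then have "open (h -` T)" if "open T" for T
    using that by (subst open_subopen) auto
  then show ?thesis by (simp add: continuous_on_open_vimage)
qed

section \<open>Conjugation of stabilisers and regular points\<close>

lemma conjugate_neighbourhood_stabiliser_subset:
  assumes G: "subgroup G homeo_group" and f: "homeomorphic_map euclidean euclidean f" "f x = y"
    and loc: "\<And>p. p \<noteq> x \<Longrightarrow> locally_in G f p"
    and h: "h \<in> neighbourhood_stabiliser (topological_full_group G) x"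
  shows "f \<circ> h \<circ> inv_into UNIV f \<in> neighbourhood_stabiliser (topological_full_group G) y"
proof -
  have bf: "bij f" and cf: "continuous_on UNIV (inv_into UNIV f)"
    using f by (auto simp: homeomorphic_map_euclidean_iff)
  have inv_y: "inv_into UNIV f y = x" using bf f(2) by (metis bij_inv_eq_iff)
  obtain U where hc: "homeomorphic_map euclidean euclidean h" and hl: "\<And>p. locally_in G h p"
    and hx: "h x = x" and U: "open U" "x \<in> U" "\<forall>u\<in>U. h u = u"
    using h by (auto simp: neighbourhood_stabiliser_def point_stabiliser_def topological_full_group_iff)
  have bh: "bij h" using hc by (simp add: homeomorphic_map_euclidean_iff)
  have oV: "open (inv_into UNIV f -` U)" using cf U(1) by (simp add: open_vimage)
  have fixed: "(f \<circ> h \<circ> inv_into UNIV f) q = q" if "q \<in> inv_into UNIV f -` U" for q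
    using that U(3) bf by (simp add: bij_is_surj surj_f_inv_f)
  have "homeomorphic_map euclidean euclidean (inv_into UNIV f)"
    using homeo_group_inv_closed[of f] f(1) by simp
  then have "homeomorphic_map euclidean euclidean (f \<circ> h \<circ> inv_into UNIV f)"
    using f(1) hc by (meson homeomorphic_map_compose)
  moreover have "locally_in G (f \<circ> h \<circ> inv_into UNIV f) q" for q
  proof (cases "q = y")
    case True
    then show ?thesis
      using oV fixed id_mem[OF G] inv_y U(2) by (intro locally_inI[of "inv_into UNIV f -` U" _ id]) auto
  next
    case False
    then have px: "inv_into UNIV f q \<noteq> x" using f(2) bf by (metis bij_inv_eq_iff)
    \<comment> \<open>\<open>h\<close> is injective and fixes \<open>x\<close>, so it moves no other
      point to \<open>x\<close>, the only point where \<open>f\<close> may fail to be locally in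
      \<open>G\<close>.\<close>
    then have hpx: "h (inv_into UNIV f q) \<noteq> x" using bh hx by (metis bij_inv_eq_iff)
    have "locally_in G (inv_into UNIV f) (f (inv_into UNIV f q))"
      using locally_in_inv[OF G f(1) loc[OF px]] .
    then have "locally_in G (inv_into UNIV f) q"
      using bf by (simp add: bij_is_surj surj_f_inv_f)
    then show ?thesis
      using locally_in_comp[OF G] loc[OF hpx] hl by (metis comp_apply comp_assoc)
  qed
  ultimately show ?thesis
    using oV fixed U(2) inv_y f(2) hx
    unfolding neighbourhood_stabiliser_def point_stabiliser_def topological_full_group_iff
    by (auto intro!: exI[of _ "inv_into UNIV f -` U"])
qed

lemma conjugate_neighbourhood_stabiliser:
  assumes G: "subgroup G homeo_group" and f: "homeomorphic_map euclidean euclidean f" "f x = y"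
    and loc: "\<And>p. p \<noteq> x \<Longrightarrow> locally_in G f p"
  shows "{f \<circ> h \<circ> inv_into UNIV f | h. h \<in> neighbourhood_stabiliser (topological_full_group G) x}
         = neighbourhood_stabiliser (topological_full_group G) y" (is "?L = ?R")
proof
  show "?L \<subseteq> ?R"
    using conjugate_neighbourhood_stabiliser_subset[OF G f loc] by blast
  \<comment> \<open>The inverse of \<open>f\<close> satisfies the same hypotheses with
    \<open>x\<close> and \<open>y\<close> exchanged, so the first inclusion applies to it.\<close>
  show "?R \<subseteq> ?L"
  proof
    fix k assume k: "k \<in> ?R"
    have bf: "bij f" using f by (simp add: homeomorphic_map_euclidean_iff)
    have hinv: "homeomorphic_map euclidean euclidean (inv_into UNIV f)" "inv_into UNIV f y = x"
      using homeo_group_inv_closed[of f] f bf by (auto simp: bij_is_inj)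
    have "locally_in G (inv_into UNIV f) q" if "q \<noteq> y" for q
    proof -
      have "inv_into UNIV f q \<noteq> x" using that f(2) bf by (metis bij_inv_eq_iff)
      then show ?thesis
        using locally_in_inv[OF G f(1) loc, of "inv_into UNIV f q"] bf
        by (simp add: bij_is_surj surj_f_inv_f)
    qed
    from conjugate_neighbourhood_stabiliser_subset[OF G hinv this k]
    have "inv_into UNIV f \<circ> k \<circ> f \<in> neighbourhood_stabiliser (topological_full_group G) x"
      using bf by (simp add: inv_inv_eq)
    moreover have "k = f \<circ> (inv_into UNIV f \<circ> k \<circ> f) \<circ> inv_into UNIV f"
      using bf by (simp add: fun_eq_iff bij_is_surj surj_f_inv_f)
    ultimately show "k \<in> ?L" by blast
  qed
qed

text \<open>An element of the full group fixing \<open>x\<close> agrees near \<open>x\<close> with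
  some \<open>g\<close> in \<open>G\<close>. This \<open>g\<close> fixes \<open>x\<close>, hence is
  trivial near \<open>x\<close> by regularity.\<close>

lemma regular_point_topological_full_group:
  assumes G: "subgroup G homeo_group" and "regular_point G x"
  shows "regular_point (topological_full_group G) x"
proof -
  have "h \<in> neighbourhood_stabiliser (topological_full_group G) x"
    if h: "h \<in> point_stabiliser (topological_full_group G) x" for h
  proof -
    have "locally_in G h x"
      using h by (simp add: point_stabiliser_def topological_full_group_iff)
    then obtain U g where U: "open U" "x \<in> U" "g \<in> G" "\<forall>u\<in>U. h u = g u"
      by (auto simp: locally_in_def)
    have "g \<in> point_stabiliser G x"
      using h U by (auto simp: point_stabiliser_def)
    then obtain V where V: "open V" "x \<in> V" "V \<subseteq> {u. g u = u}"
      using assms(2) by (auto simp: regular_point_def neighbourhood_stabiliser_def)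
    have "open (U \<inter> V)" "x \<in> U \<inter> V" "U \<inter> V \<subseteq> {u. h u = u}" using U V by auto
    then show ?thesis using h unfolding neighbourhood_stabiliser_def by blast
  qed
  then show ?thesis
    by (auto simp: regular_point_def neighbourhood_stabiliser_def)
qed

lemma conjugation_is_iso:
  assumes f: "bij f" and HK: "{f \<circ> h \<circ> inv_into UNIV f | h. h \<in> H} = K"
  shows "homeo_group\<lparr>carrier := H\<rparr> \<cong> homeo_group\<lparr>carrier := K\<rparr>"
proof -
  have "inj_on (\<lambda>h. f \<circ> h \<circ> inv_into UNIV f) H"
  proof (rule inj_onI)
    fix h k assume "f \<circ> h \<circ> inv_into UNIV f = f \<circ> k \<circ> inv_into UNIV f"
    then have "(f \<circ> h \<circ> inv_into UNIV f) (f u) = (f \<circ> k \<circ> inv_into UNIV f) (f u)" for u by simp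
    then show "h = k" using f by (auto simp: bij_is_inj fun_eq_iff inj_eq)
  qed
  moreover have "(\<lambda>h. f \<circ> h \<circ> inv_into UNIV f) ` H = K" using HK by auto
  moreover have "f \<circ> (h \<circ> k) \<circ> inv_into UNIV f = (f \<circ> h \<circ> inv_into UNIV f) \<circ> (f \<circ> k \<circ> inv_into UNIV f)" for h k
    using f by (simp add: fun_eq_iff bij_is_inj)
  ultimately have "(\<lambda>h. f \<circ> h \<circ> inv_into UNIV f) \<in> iso (homeo_group\<lparr>carrier := H\<rparr>) (homeo_group\<lparr>carrier := K\<rparr>)"
    by (auto simp: iso_def hom_def bij_betw_def homeo_group_def)
  then show ?thesis by (auto simp: is_iso_def)
qed

section \<open>Cylinder sets of the Cantor space\<close>

definition cylinder :: "cantor \<Rightarrow> nat \<Rightarrow> cantor set"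
  where "cylinder x n = {p. \<forall>i<n. p i = x i}"

lemma mem_cylinder [simp]: "x \<in> cylinder x n"
  by (simp add: cylinder_def)

lemma clopen_cylinder: "open (cylinder x n)" "closed (cylinder x n)"
proof -
  have c: "continuous_on UNIV (\<lambda>p::cantor. p i)" for i
    by (rule continuous_on_product_coordinates)
  have "open ((\<lambda>p::cantor. p i) -` {x i})" "closed ((\<lambda>p::cantor. p i) -` {x i})" for i
    using c[of i] by (simp_all add: open_vimage closed_vimage open_discrete)
  moreover have "cylinder x n = (\<Inter>i<n. (\<lambda>p::cantor. p i) -` {x i})"
    by (auto simp: cylinder_def)
  ultimately show "open (cylinder x n)" "closed (cylinder x n)"
    by (auto intro!: open_INT closed_INT)
qed

text \<open>A basic open box restricts only finitely many coordinates, so a long enough prefix of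
  \<open>x\<close> forces membership.\<close>

lemma cylinder_basis:
  assumes "open U" "x \<in> U"
  obtains n where "cylinder x n \<subseteq> U"
proof -
  obtain X where X: "x \<in> Pi\<^sub>E UNIV X" "finite {i. X i \<noteq> UNIV}" "Pi\<^sub>E UNIV X \<subseteq> U"
    using product_topology_open_contains_basis[OF assms(1)[unfolded open_fun_def] assms(2)]
    unfolding topspace_euclidean by metis
  then obtain n where n: "\<And>i. X i \<noteq> UNIV \<Longrightarrow> i < n"
    by (auto simp: finite_nat_set_iff_bounded)
  have "cylinder x n \<subseteq> Pi\<^sub>E UNIV X"
  proof
    fix p assume p: "p \<in> cylinder x n"
    have "p i \<in> X i" for i
      using p n[of i] X(1) by (cases "X i = UNIV") (auto simp: cylinder_def)
    then show "p \<in> Pi\<^sub>E UNIV X" by auto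
  qed
  then show ?thesis using X(3) by (intro that) (rule subset_trans)
qed

lemma cylinder_separation:
  assumes "p \<noteq> x"
  obtains n where "p \<notin> cylinder x (Suc n)"
proof -
  obtain i where "p i \<noteq> x i" using assms by auto
  then show ?thesis by (intro that[of i]) (auto simp: cylinder_def)
qed

lemma open_Compl_point: "open (- {x :: cantor})"
proof (subst open_subopen, intro ballI)
  fix p assume "p \<in> - {x}"
  then obtain n where "p \<notin> cylinder x (Suc n)" using cylinder_separation[of p x] by auto
  then show "\<exists>T. open T \<and> p \<in> T \<and> T \<subseteq> - {x}"
    using clopen_cylinder by (intro exI[of _ "- cylinder x (Suc n)"]) auto
qed

section \<open>Elements of the full group with small support\<close>

text \<open>If \<open>v\<close> is not yet in \<open>D\<close>, minimality gives \<open>g\<close> in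
  \<open>G\<close> with \<open>g v\<close> in \<open>D\<close>. Applying \<open>g\<close> on a small
  clopen set \<open>E\<close> around \<open>v\<close>, its inverse on the image of \<open>E\<close>,
  and the identity elsewhere gives an involution, provided that \<open>E\<close> and its image are
  disjoint.\<close>

lemma exists_full_group_move:
  fixes v y :: cantor
  assumes G: "subgroup G homeo_group" and minimal: "minimal_action G"
    and C: "open C" "v \<in> C" and D: "open D" "y \<in> D"
    and orbit: "\<And>g. g \<in> G \<Longrightarrow> g v \<noteq> y"
  obtains s where "s \<in> topological_full_group G" "s v \<in> D" "s y = y"
    "\<And>p. p \<notin> C \<union> D \<Longrightarrow> s p = p"
proof (cases "v \<in> D")
  case True
  then show ?thesis
    using that[of id] subgroup.one_closed[OF subgroup_topological_full_group[OF G]] by simp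
next
  case False
  have "y \<in> closure {g v |g. g \<in> G}" using minimal by (auto simp: minimal_action_def)
  then have "D \<inter> {g v |g. g \<in> G} \<noteq> {}" using D open_Int_closure_eq_empty[OF D(1)] by blast
  then obtain g where g: "g \<in> G" "g v \<in> D" by blast
  have bg: "bij g" and cg: "continuous_on UNIV g" "continuous_on UNIV (inv_into UNIV g)"
    using homeomorphic_map_mem[OF G g(1)] by (auto simp: homeomorphic_map_euclidean_iff)
  \<comment> \<open>\<open>P\<close> is a clopen set separating \<open>v\<close> from
    \<open>g v\<close>. Keeping \<open>E\<close> in \<open>P\<close> and its image in the complement
    \<open>Q\<close> makes them disjoint.\<close>
  have "g v \<noteq> v" using g False by auto
  then obtain m where m: "g v \<notin> cylinder v m" using cylinder_separation by metis
  define P where "P = cylinder v m"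
  define Q where "Q = - P"
  have PQ: "open P" "open Q" "v \<in> P" "g v \<in> Q" "P \<inter> Q = {}"
    using m clopen_cylinder by (auto simp: P_def Q_def open_Compl)
  \<comment> \<open>All requirements on \<open>E\<close> at once; the last two keep \<open>y\<close>
    out of \<open>E\<close> and its image. That \<open>v\<close> meets them is \<open>orbit\<close>
    for \<open>id\<close> and for \<open>g\<close>.\<close>
  define O' where "O' = C \<inter> P \<inter> g -` (D \<inter> Q) \<inter> - {y} \<inter> g -` (- {y})"
  have "open O'" unfolding O'_def
    using C D PQ cg by (intro open_Int open_vimage open_Compl_point) auto
  moreover have "v \<in> O'"
    using C PQ g orbit[OF g(1)] orbit[OF id_mem[OF G]] by (auto simp: O'_def)
  ultimately obtain n where n: "cylinder v n \<subseteq> O'" by (rule cylinder_basis)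
  define E where "E = cylinder v n"
  have E: "open E" "closed E" "v \<in> E" "E \<subseteq> O'"
    using clopen_cylinder n by (auto simp: E_def)
  \<comment> \<open>The image of \<open>E\<close> under \<open>g\<close>, written as a preimage so
    that it is clopen by continuity.\<close>
  define F where "F = inv_into UNIV g -` E"
  have F: "open F" "closed F" using E cg by (auto simp: F_def open_vimage closed_vimage)
  have gF: "g p \<in> F \<longleftrightarrow> p \<in> E" for p using bg by (simp add: F_def bij_is_inj)
  have Fg: "p \<in> F \<Longrightarrow> \<exists>q\<in>E. p = g q" for p
    using bg by (auto simp: F_def intro!: bexI[of _ "inv_into UNIV g p"] simp: bij_is_surj surj_f_inv_f)
  have disj: "E \<inter> F = {}" using Fg E(4) PQ(5) unfolding O'_def by blast
  define s where "s = (\<lambda>p. if p \<in> E then g p else if p \<in> F then inv_into UNIV g p else p)"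
  have loc: "locally_in G s p" for p
  proof -
    consider "p \<in> E" | "p \<in> F" | "p \<in> - (E \<union> F)" by blast
    then show ?thesis
    proof cases
      case 1
      then show ?thesis using E g by (intro locally_inI[of E _ g]) (auto simp: s_def)
    next
      case 2
      then show ?thesis using F inv_mem[OF G g(1)] disj
        by (intro locally_inI[of F _ "inv_into UNIV g"]) (auto simp: s_def)
    next
      case 3
      then show ?thesis using E F id_mem[OF G]
        by (intro locally_inI[of "- (E \<union> F)" _ id]) (auto simp: s_def)
    qed
  qed
  have ss: "s (s p) = p" for p
    using disj gF Fg bg by (auto simp: s_def F_def bij_is_inj bij_is_surj surj_f_inv_f)
  \<comment> \<open>An involution is its own inverse, so continuity of \<open>s\<close> already
    makes it a homeomorphism.\<close>
  then have "bij s" "inv_into UNIV s = s" by (auto intro: involuntory_imp_bij inv_equality)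
  then have "s \<in> topological_full_group G"
    using loc locally_in_continuous[OF G]
    by (auto simp: topological_full_group_iff homeomorphic_map_euclidean_iff)
  moreover have "s v \<in> D" using E g by (simp add: s_def)
  moreover have "y \<notin> E" "y \<notin> F" using E(4) Fg unfolding O'_def by blast+
  then have "s y = y" by (simp add: s_def)
  moreover have "E \<subseteq> C" "F \<subseteq> D" using E(4) Fg unfolding O'_def by blast+
  then have "s p = p" if "p \<notin> C \<union> D" for p using that by (auto simp: s_def)
  ultimately show ?thesis using that[of s] by blast
qed

section \<open>One refinement step\<close>

lemma full_group_orbit:
  assumes "h \<in> topological_full_group G"
  obtains g where "g \<in> G" "h p = g p"
proof -
  have "locally_in G h p" using assms by (simp add: topological_full_group_iff)
  then show ?thesis using that by (auto simp: locally_in_def)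
qed

text \<open>Let \<open>A\<close> be the preimage of \<open>B\<close> under \<open>h\<close>.
  Precomposing \<open>h\<close> with the inverse of a move \<open>t\<close> inside \<open>A\<close>
  brings the preimage of \<open>y\<close> into \<open>V\<close>; postcomposing with a move
  \<open>s\<close> then brings the image of \<open>x\<close> into a small clopen \<open>N\<close>
  around \<open>y\<close>, the new \<open>B'\<close>. Both moves act trivially on points coming from
  outside \<open>A\<close>.\<close>

lemma full_group_refinement:
  fixes x y :: cantor
  assumes G: "subgroup G homeo_group" and minimal: "minimal_action G"
    and orbit: "\<And>g. g \<in> G \<Longrightarrow> g x \<noteq> y"
    and h: "h \<in> topological_full_group G" and B: "open B" "y \<in> B" "h x \<in> B"
    and V: "open V" "x \<in> V" and W: "open W" "y \<in> W"
  obtains h' B' where "h' \<in> topological_full_group G" "open B'" "closed B'" "y \<in> B'" "h' x \<in> B'"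
    "B' \<subseteq> B \<inter> W" "h' -` B' \<subseteq> h -` B \<inter> V" "\<And>p. h p \<notin> B \<Longrightarrow> h' p = h p"
proof -
  note full = subgroup_topological_full_group[OF G]
  have orbit': "k x \<noteq> y" if "k \<in> topological_full_group G" for k
    using full_group_orbit[OF that] orbit by metis
  have full_homeo: "bij k \<and> continuous_on UNIV k \<and> continuous_on UNIV (inv_into UNIV k)"
    if "k \<in> topological_full_group G" for k
    using that by (simp add: topological_full_group_iff homeomorphic_map_euclidean_iff)
  note hh = full_homeo[OF h]
  define A where "A = h -` B"
  have A: "open A" "x \<in> A" "inv_into UNIV h y \<in> A"
    using B hh by (auto simp: A_def open_vimage bij_is_surj surj_f_inv_f)
  \<comment> \<open>If \<open>g\<close> moved the preimage of \<open>y\<close> to \<open>x\<close>,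
    then \<open>h\<close> after the inverse of \<open>g\<close> would be an element of the full
    group taking \<open>x\<close> to \<open>y\<close>.\<close>
  have "g (inv_into UNIV h y) \<noteq> x" if "g \<in> G" for g
  proof
    assume "g (inv_into UNIV h y) = x"
    moreover have "h \<circ> inv_into UNIV g \<in> topological_full_group G"
    proof -
      have "inv_into UNIV g \<in> topological_full_group G"
        using inv_mem[OF G that] homeomorphic_map_mem[OF G] locally_in_mem
        by (metis topological_full_group_iff)
      then show ?thesis using subgroup.m_closed[OF full h] by simp
    qed
    moreover have "bij g"
      using homeomorphic_map_mem[OF G that] by (simp add: homeomorphic_map_euclidean_iff)
    ultimately show False
      using orbit' hh by (metis bij_inv_eq_iff comp_apply)
  qed
  then obtain t where t: "t \<in> topological_full_group G" "t (inv_into UNIV h y) \<in> V \<inter> A" "t x = x"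
    "\<And>p. p \<notin> A \<union> (V \<inter> A) \<Longrightarrow> t p = p"
    using exists_full_group_move[OF G minimal A(1) A(3), of "V \<inter> A" x thesis] A V by auto
  note ht = full_homeo[OF t(1)]
  define h1 where "h1 = h \<circ> inv_into UNIV t"
  have "inv_into UNIV t \<in> topological_full_group G" using inv_mem[OF full t(1)] .
  then have h1: "h1 \<in> topological_full_group G"
    using subgroup.m_closed[OF full h] by (simp add: h1_def)
  note hh1 = full_homeo[OF h1]
  have t_off: "inv_into UNIV t p = p" if "p \<notin> A" for p
    using ht t(4)[of p] that by (metis Int_iff Un_iff bij_inv_eq_iff)
  have t_A: "inv_into UNIV t p \<in> A \<longleftrightarrow> p \<in> A" for p
    using ht t(4) t_off by (metis Int_iff Un_iff bij_inv_eq_iff)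
  \<comment> \<open>The image of \<open>V \<inter> A\<close> under \<open>h1\<close>: a
    neighbourhood of \<open>y\<close> to which \<open>s\<close> will be confined.\<close>
  define C where "C = inv_into UNIV h1 -` (V \<inter> A)"
  have C: "open C" using hh1 V A by (auto simp: C_def open_vimage)
  have h1C: "h1 p \<in> C \<longleftrightarrow> p \<in> V \<inter> A" for p using hh1 by (simp add: C_def bij_is_inj)
  have h1x: "h1 x = h x" using ht t(3) by (metis h1_def bij_inv_eq_iff comp_apply)
  have "h1 (t (inv_into UNIV h y)) = y" using ht hh
    by (simp add: h1_def bij_is_inj bij_is_surj surj_f_inv_f)
  then have yC: "y \<in> C" using h1C t(2) by metis
  obtain n where n: "cylinder y n \<subseteq> C \<inter> B \<inter> W"
    using cylinder_basis[of "C \<inter> B \<inter> W" y] C B W yC by (metis IntI open_Int)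
  define N where "N = cylinder y n"
  have N: "open N" "closed N" "y \<in> N" "N \<subseteq> C \<inter> B \<inter> W"
    using n clopen_cylinder by (auto simp: N_def)
  have "g (h1 x) \<noteq> y" if "g \<in> G" for g
  proof -
    obtain k where "k \<in> G" "h1 x = k x" using full_group_orbit[OF h1] by metis
    then show ?thesis using orbit[of "g \<circ> k"] subgroup.m_closed[OF G that, of k] by auto
  qed
  then obtain s where s: "s \<in> topological_full_group G" "s (h1 x) \<in> N" "s y = y"
    "\<And>p. p \<notin> C \<union> N \<Longrightarrow> s p = p"
    using exists_full_group_move[OF G minimal C, of "h1 x" N y thesis] h1C A V N by auto
  \<comment> \<open>As \<open>N\<close> lies in \<open>C\<close>, \<open>s\<close> is the identity
    off \<open>C\<close> and brings no outside point into \<open>C\<close>. Hence the preimage of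
    \<open>N\<close> under \<open>s \<circ> h1\<close> stays in \<open>V \<inter> A\<close>.\<close>
  have s_C: "p \<in> C" if "s p \<in> C" for p
  proof (rule ccontr)
    assume "p \<notin> C"
    moreover from this have "s p = p" using s(4)[of p] N(4) by blast
    ultimately show False using that by simp
  qed
  show ?thesis
  proof (rule that[of "s \<circ> h1" N])
    show "s \<circ> h1 \<in> topological_full_group G" using subgroup.m_closed[OF full s(1) h1] by simp
    have "p \<in> V \<inter> A" if "s (h1 p) \<in> N" for p
      using s_C[of "h1 p"] h1C N(4) that by blast
    then show "(s \<circ> h1) -` N \<subseteq> h -` B \<inter> V" by (auto simp: A_def)
    show "(s \<circ> h1) p = h p" if "h p \<notin> B" for p
    proof -
      have "p \<notin> A" using that by (simp add: A_def)
      then have "h1 p = h p" "h1 p \<notin> C" using h1C[of p] t_off[of p] by (auto simp: h1_def)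
      then show ?thesis using s(4)[of "h1 p"] N(4) by auto
    qed
  qed (use N s in auto)
qed

section \<open>The limit homeomorphism\<close>

text \<open>Near a point other than \<open>x\<close> the sequence is eventually constant, so the
  limit inherits local membership in \<open>G\<close>. Continuity at \<open>x\<close> holds because
  the limit maps \<open>A n\<close> into \<open>B n\<close>, which shrinks to
  \<open>y\<close>.\<close>

lemma exists_homeomorphism_locally_in:
  fixes x y :: cantor
  assumes G: "subgroup G homeo_group" and minimal: "minimal_action G"
    and orbit: "\<And>g. g \<in> G \<Longrightarrow> g x \<noteq> y"
  obtains f where "homeomorphic_map euclidean euclidean f" "f x = y"
    "\<And>p. p \<noteq> x \<Longrightarrow> locally_in G f p"
proof -
  define P where "P = (\<lambda>(h, B). h \<in> topological_full_group G \<and> open B \<and> closed B \<and> y \<in> B \<and> h x \<in> B)"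
  define R where "R = (\<lambda>n (h :: cantor \<Rightarrow> cantor, B) (h' :: cantor \<Rightarrow> cantor, B'). B' \<subseteq> B \<inter> cylinder y n
    \<and> h' -` B' \<subseteq> h -` B \<inter> cylinder x n \<and> (\<forall>p. h p \<notin> B \<longrightarrow> h' p = h p))"
  have "P (id, UNIV)"
    using subgroup.one_closed[OF subgroup_topological_full_group[OF G]] by (simp add: P_def)
  then have base: "\<exists>z. P z" by blast
  have step: "\<exists>z'. P z' \<and> R n z z'" if "P z" for z n
  proof -
    obtain h B where z: "z = (h, B)" by fastforce
    have h: "h \<in> topological_full_group G" "open B" "y \<in> B" "h x \<in> B"
      using that by (simp_all add: z P_def)
    show ?thesis
    proof (rule full_group_refinement[where G = G and h = h and B = B and x = x and y = y
          and V = "cylinder x n" and W = "cylinder y n"])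
      fix h' B'
      assume "h' \<in> topological_full_group G" "open B'" "closed B'" "y \<in> B'" "h' x \<in> B'"
        "B' \<subseteq> B \<inter> cylinder y n" "h' -` B' \<subseteq> h -` B \<inter> cylinder x n"
        "\<And>p. h p \<notin> B \<Longrightarrow> h' p = h p"
      then show ?thesis
        by (intro exI[of _ "(h', B')"]) (simp add: z P_def R_def)
    qed (use G minimal orbit h clopen_cylinder in simp_all)
  qed
  have "\<exists>z. \<forall>n. P (z n) \<and> R n (z n) (z (Suc n))"
    by (rule dependent_nat_choice) (rule base, rule step)
  then obtain z where z: "\<And>n. P (z n)" "\<And>n. R n (z n) (z (Suc n))" by blast
  define h where "h n = fst (z n)" for n
  define B where "B n = snd (z n)" for n
  define A where "A n = h n -` B n" for n
  have P: "h n \<in> topological_full_group G" "open (B n)" "closed (B n)" "y \<in> B n" "x \<in> A n" for n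
    using z(1)[of n] by (auto simp: P_def h_def B_def A_def split: prod.splits)
  have R: "B (Suc n) \<subseteq> B n" "B (Suc n) \<subseteq> cylinder y n" "A (Suc n) \<subseteq> A n"
    "A (Suc n) \<subseteq> cylinder x n" "p \<notin> A n \<Longrightarrow> h (Suc n) p = h n p" for n p
    using z(2)[of n] by (auto simp: R_def h_def B_def A_def split: prod.splits)
  have bij: "bij (h n)" and cont: "continuous_on UNIV (h n)" for n
    using P(1)[of n] by (auto simp: topological_full_group_iff homeomorphic_map_euclidean_iff)
  have clA: "closed (A n)" "open (A n)" for n
    using P cont by (auto simp: A_def closed_vimage open_vimage)
  have antiA: "A m \<subseteq> A n" if "n \<le> m" for n m 
    using lift_Suc_antimono_le[of A, OF R(3) that] .
  have h_eq: "h m p = h n p" if "n \<le> m" "p \<notin> A n" for n m p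
    using that
  proof (induction m rule: dec_induct)
    case (step m)
    then have "p \<notin> A m" using antiA by blast
    then show ?case using step R(5) by simp
  qed simp
  \<comment> \<open>Otherwise the preimage \<open>q\<close> of \<open>h m p\<close> under
    \<open>h n\<close> lies outside \<open>A n\<close>, where \<open>h m\<close> and
    \<open>h n\<close> agree. Then \<open>h m\<close> takes the same value at \<open>p\<close> and
    at \<open>q \<noteq> p\<close>.\<close>
  have hB: "h m p \<in> B n" if "n \<le> m" "p \<in> A n" for n m p
  proof (rule ccontr)
    assume *: "h m p \<notin> B n"
    define q where "q = inv_into UNIV (h n) (h m p)"
    have q: "h n q = h m p" using bij by (simp add: q_def bij_is_surj surj_f_inv_f)
    then have "q \<notin> A n" using * by (simp add: A_def)
    then have "h m q = h m p" "q \<noteq> p" using h_eq[OF that(1)] q that(2) by auto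
    then show False using bij by (metis bij_is_inj injD)
  qed
  have sepA: "\<exists>n. p \<notin> A n" if px: "p \<noteq> x" for p
  proof -
    obtain n where "p \<notin> cylinder x (Suc n)" using cylinder_separation[OF px] .
    \<comment> \<open>The set with index \<open>Suc k\<close> lies in the cylinder of length
      \<open>k\<close>, whence the double successor.\<close>
    then have "p \<notin> A (Suc (Suc n))" using R(4)[of "Suc n"] by auto
    then show ?thesis ..
  qed
  have sepB: "\<exists>n. q \<notin> B n" if qy: "q \<noteq> y" for q
  proof -
    obtain n where "q \<notin> cylinder y (Suc n)" using cylinder_separation[OF qy] .
    then have "q \<notin> B (Suc (Suc n))" using R(2)[of "Suc n"] by auto
    then show ?thesis ..
  qed
  \<comment> \<open>From the first stage at which \<open>p\<close> has left \<open>A n\<close> on,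
    \<open>h n p\<close> is constant. Only \<open>x\<close> never leaves, and gets the value
    \<open>y\<close>.\<close>
  define f where "f p = (if p = x then y else h (LEAST n. p \<notin> A n) p)" for p
  have fx: "f x = y" by (simp add: f_def)
  have f_eq: "f p = h n p" if "p \<notin> A n" for n p
  proof -
    have "p \<notin> A (LEAST n. p \<notin> A n)" using LeastI[of "\<lambda>n. p \<notin> A n", OF that] .
    moreover have "(LEAST n. p \<notin> A n) \<le> n" using Least_le[of "\<lambda>n. p \<notin> A n", OF that] .
    moreover have "p \<noteq> x" using that P(5) by auto
    ultimately show ?thesis using h_eq by (simp add: f_def)
  qed
  have fB: "f p \<in> B n" if "p \<in> A n" for n p
  proof (cases "p = x")
    case False
    then obtain m where m: "p \<notin> A m" using sepA by blast
    \<comment> \<open>\<open>p\<close> is still in \<open>A n\<close> but no longer in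
      \<open>A m\<close>, and the sets decrease.\<close>
    then have "n \<le> m" using antiA[of m n] that by (metis nle_le subsetD)
    then show ?thesis using f_eq[OF m] hB that by simp
  qed (use fx P in simp)
  have loc: "locally_in G f p" if px: "p \<noteq> x" for p
  proof -
    obtain n where n: "p \<notin> A n" using sepA px by blast
    have "locally_in G (h n) p" using P(1)[of n] by (simp add: topological_full_group_iff)
    then obtain U g where U: "open U" "p \<in> U" "g \<in> G" "\<forall>u\<in>U. h n u = g u"
      by (auto simp: locally_in_def)
    \<comment> \<open>\<open>A n\<close> is closed, so removing it leaves a neighbourhood of
      \<open>p\<close>, on which \<open>f\<close> is \<open>h n\<close>.\<close>
    show ?thesis
      using U n clA f_eq by (intro locally_inI[of "U - A n" _ g]) auto
  qed
  have "\<exists>S. open S \<and> p \<in> S \<and> S \<subseteq> f -` T" if T: "open T" "f p \<in> T" for p T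
  proof (cases "p = x")
    case True
    then obtain n where "cylinder y n \<subseteq> T" using cylinder_basis[OF T] fx by metis
    then have "A (Suc n) \<subseteq> f -` T" using fB[of _ "Suc n"] R(2)[of n] by blast
    then show ?thesis using clA(2) P(5) True by blast
  next
    case False
    then obtain n where n: "p \<notin> A n" using sepA by blast
    have "open (h n -` T - A n)" using cont clA(1) T(1) by (intro open_Diff open_vimage)
    then show ?thesis
      using n T f_eq by (intro exI[of _ "h n -` T - A n"]) auto
  qed
  then have "open (f -` T)" if "open T" for T
    using that by (subst open_subopen) auto
  then have cf: "continuous_on UNIV f" by (simp add: continuous_on_open_vimage)
  have fy: "f p \<noteq> y" if px: "p \<noteq> x" for p
  proof -
    obtain n where n: "p \<notin> A n" using sepA px by blast
    then have "f p \<notin> B n" using f_eq by (simp add: A_def)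
    then show ?thesis using P(4) by auto
  qed
  have "inj f"
  proof (rule injI)
    fix p q assume eq: "f p = f q"
    show "p = q"
    proof (cases "p = x \<or> q = x")
      case True
      then show ?thesis using fy fx eq by metis
    next
      case False
      obtain m n where "p \<notin> A m" "q \<notin> A n" using sepA False by blast
      \<comment> \<open>At a common stage both points have left, so \<open>f\<close> agrees at both
        with a single injective map.\<close>
      then have "p \<notin> A (max m n)" "q \<notin> A (max m n)"
        using antiA by (meson max.cobounded1 max.cobounded2 subsetD)+
      then show ?thesis using eq f_eq bij by (metis bij_is_inj injD)
    qed
  qed
  moreover have "surj f"
  proof -
    have "q \<in> range f" for q
    proof (cases "q = y")
      case True
      then show ?thesis using fx by blast
    next
      case False
      \<comment> \<open>The preimage of \<open>q\<close> under \<open>h n\<close> lies outside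
        \<open>A n\<close> once \<open>q\<close> is outside \<open>B n\<close>, and there
        \<open>f\<close> is \<open>h n\<close>.\<close>
      then obtain n where n: "q \<notin> B n" using sepB by blast
      define p where "p = inv_into UNIV (h n) q"
      have "h n p = q" using bij by (simp add: p_def bij_is_surj surj_f_inv_f)
      moreover from this n have "p \<notin> A n" by (simp add: A_def)
      ultimately show ?thesis using f_eq by (metis rangeI)
    qed
    then show ?thesis by blast
  qed
  \<comment> \<open>A continuous bijection from a compact space to a Hausdorff space is a
    homeomorphism; both properties pass from the two-point factor to the product.\<close>
  moreover have "compact_space (euclidean :: bool topology)"
    by (simp add: compact_space_def finite_imp_compact)
  then have "compact_space (euclidean :: cantor topology)"
    unfolding euclidean_product_topology[symmetric] by (simp add: compact_space_product_topology)
  moreover have "Hausdorff_space (euclidean :: bool topology)"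
    unfolding Hausdorff_space_def disjnt_def
    by (metis Int_insert_left_if0 Int_empty_left singletonD open_discrete open_openin singletonI)
  then have "Hausdorff_space (euclidean :: cantor topology)"
    unfolding euclidean_product_topology[symmetric] by (simp add: Hausdorff_space_product_topology)
  ultimately have "homeomorphic_map euclidean euclidean f"
    using cf by (intro continuous_imp_homeomorphic_map) auto
  then show ?thesis using that[of f] fx loc by blast
qed

theorem corollary3p1:
  fixes G :: "(cantor \<Rightarrow> cantor) set"
  assumes "subgroup G homeo_group"
    and "minimal_action G"
  shows "\<forall>x y.
    (\<exists>f. homeomorphic_map euclidean euclidean f \<and>
       {f \<circ> h \<circ> inv_into UNIV f | h. h \<in> neighbourhood_stabiliser (topological_full_group G) x}
         = neighbourhood_stabiliser (topological_full_group G) y) \<and>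
    (regular_point G x \<and> regular_point G y \<longrightarrow>
       homeo_group\<lparr>carrier := point_stabiliser (topological_full_group G) x\<rparr>
         \<cong> homeo_group\<lparr>carrier := point_stabiliser (topological_full_group G) y\<rparr>)"
proof (intro allI)
  fix x y :: cantor
  obtain f where f: "homeomorphic_map euclidean euclidean f" "f x = y"
    "\<And>p. p \<noteq> x \<Longrightarrow> locally_in G f p"
  proof (cases "\<exists>g\<in>G. g x = y")
    case True
    then show ?thesis
      using that homeomorphic_map_mem[OF assms(1)] locally_in_mem by blast
  next
    case False
    then show ?thesis
      using exists_homeomorphism_locally_in[OF assms] that by blast
  qed
  note conj = conjugate_neighbourhood_stabiliser[OF assms(1) f]
  have "bij f" using f by (simp add: homeomorphic_map_euclidean_iff)
  then have "homeo_group\<lparr>carrier := neighbourhood_stabiliser (topological_full_group G) x\<rparr>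
      \<cong> homeo_group\<lparr>carrier := neighbourhood_stabiliser (topological_full_group G) y\<rparr>"
    using conj by (rule conjugation_is_iso)
  \<comment> \<open>Regularity for \<open>G\<close> passes to the full group, so at regular points
    the isomorphism just obtained is one of point stabilisers.\<close>
  moreover have "neighbourhood_stabiliser (topological_full_group G) w
      = point_stabiliser (topological_full_group G) w" if "regular_point G w" for w
    using regular_point_topological_full_group[OF assms(1) that] by (simp add: regular_point_def)
  ultimately show "(\<exists>f. homeomorphic_map euclidean euclidean f \<and>
       {f \<circ> h \<circ> inv_into UNIV f | h. h \<in> neighbourhood_stabiliser (topological_full_group G) x}
         = neighbourhood_stabiliser (topological_full_group G) y) \<and>
    (regular_point G x \<and> regular_point G y \<longrightarrow>
       homeo_group\<lparr>carrier := point_stabiliser (topological_full_group G) x\<rparr>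
         \<cong> homeo_group\<lparr>carrier := point_stabiliser (topological_full_group G) y\<rparr>)"
    using f(1) conj by (intro conjI exI[of _ f]) auto
qed

end
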